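(* Let $n=n_1+n_2$ with $n_1,n_2\ge 1$, and let $\boldsymbol{B}\in\mathbb{R}^{n\times n}$ be the (positive definite) network grounded Laplacian matrix of an ac network with $n$ inverter nodes, where identical grid-following (GFL) inverters are connected to nodes $1,\dots,n_1$ and identical grid-forming (GFM) inverters to nodes $n_1+1,\dots,n$. Let $B_{eq}>0$ be the equivalent susceptance of the GFM inverters, set $$\boldsymbol{B}_{mod}=\boldsymbol{B}+\left(0_{n_1\times n_1}\oplus B_{eq}\mathbb{I}_{n_2}\right),$$ and let $$\boldsymbol{B}_{mod}/n_2=\boldsymbol{B}_{mod}[n_1,n_1]-\boldsymbol{B}_{mod}[n_1,n_2]\,\boldsymbol{B}_{mod}[n_2,n_2]^{-1}\,\boldsymbol{B}_{mod}[n_2,n_1]$$ be the Schur complement of $\boldsymbol{B}_{mod}[n_2,n_2]$ in $\boldsymbol{B}_{mod}$. Then: (a) The network grounded Laplacian matrix of subsystem 1 (the decoupled GFL subsystem of the hybrid system, defined in the context) can be considered as $\boldsymbol{B}_{mod}/n_2$, in the sense that its network admittance matrix is written as $\boldsymbol{Y}_N^{sub1}=(\boldsymbol{B}_{mod}/n_2)\otimes F$ when the GFM admittance is represented by the equivalent susceptance $B_{eq}$. (b) The smallest eigenvalues of the network grounded Laplacian matrices of subsystem 1 and of system $\Gamma_1$ (the system on the same network with GFL inverters at all $n$ nodes, whose grounded Laplacian is $\boldsymbol{B}$) satisfy $$\underline{\lambda}\{\boldsymbol{B}_{mod}/n_2\}>\underline{\lambda}\{\boldsymbol{B}\}.$$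
   Context: Network: $n$ inverter nodes are dynamically coupled through an ac network that also contains infinite (grounded) nodes and interior nodes. The matrix $\boldsymbol{B}$ is the network susceptance matrix, which is also the grounded Laplacian matrix obtained by preserving the $n$ inverter nodes and eliminating the infinite nodes and the interior nodes (Kron reduction); it is real symmetric and positive definite. The network dynamics are modelled by the admittance $\boldsymbol{Y}_N(s)=\boldsymbol{B}\otimes F(s)$, with $F(s)=\frac{1}{s^2/\omega_0+\omega_0}\begin{bmatrix}s&\omega_0\\-\omega_0&s\end{bmatrix}$ and $\omega_0$ the nominal angular frequency. Systems: $\Gamma_1$ has GFL inverters, each with $2\times2$ admittance $Y_{GFL}(s)$, at all $n$ nodes. The hybrid system has GFL inverters at nodes $1,\dots,n_1$ and GFM inverters, each with $2\times2$ admittance $Y_{GFM}(s)$, at the other $n_2$ nodes. Subsystem 1 of the hybrid system consists of the $n_1$ GFL inverters (admittance $\mathbb{I}_{n_1}\otimes Y_{GFL}$) connected to the network admittance obtained by absorbing the GFM inverters into the network: $$\boldsymbol{Y}_N^{sub1}=\boldsymbol{B}[n_1,n_1]\otimes F-(\boldsymbol{B}[n_1,n_2]\otimes F)\left(\boldsymbol{B}[n_2,n_2]\otimes F+\mathbb{I}_{n_2}\otimes Y_{GFM}\right)^{-1}(\boldsymbol{B}[n_2,n_1]\otimes F).$$ The number $B_{eq}>0$ is the equivalent susceptance used to approximate $Y_{GFM}$ in this formula at the frequency points of interest (that is, $Y_{GFM}$ is represented by $B_{eq}F$). Notation: $\underline{\lambda}\{\cdot\}$ is the smallest eigenvalue;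 $\mathbb{I}_m$ is the $m\times m$ identity matrix; $\otimes$ is the Kronecker product; $\oplus$ is the direct sum (block-diagonal concatenation). For an $n\times n$ matrix $M$, $M[n_1,n_1]$, $M[n_1,n_2]$, $M[n_2,n_1]$, $M[n_2,n_2]$ are its blocks, where the label $n_1$ refers to the indices $1,\dots,n_1$ and the label $n_2$ to the indices $n_1+1,\dots,n$. *)

theory Defs
  imports "HOL-Analysis.Analysis"
begin

section \<open>Matrices\<close>

definition eigenvalue :: "real^'n^'n \<Rightarrow> real \<Rightarrow> bool" where
  "eigenvalue A c \<longleftrightarrow> (\<exists>v. v \<noteq> 0 \<and> A *v v = c *\<^sub>R v)"

text \<open>Only used for symmetric matrices, whose spectrum is real, finite and nonempty.\<close>

definition smallest_eigenvalue :: "real^'n^'n \<Rightarrow> real" where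
  "smallest_eigenvalue A = Min {c. eigenvalue A c}"

definition sym_pos_def :: "real^'n^'n \<Rightarrow> bool" where
  "sym_pos_def A \<longleftrightarrow> transpose A = A \<and> (\<forall>x. x \<noteq> 0 \<longrightarrow> x \<bullet> (A *v x) > 0)"

definition kronecker :: "'a::times^'n^'m \<Rightarrow> 'a^'q^'p \<Rightarrow> 'a^('n \<times> 'q)^('m \<times> 'p)"
    (infixl "\<otimes>\<^sub>K" 75) where
  "A \<otimes>\<^sub>K C = (\<chi> i j. A $ fst i $ fst j * C $ snd i $ snd j)"

definition direct_sum :: "'a::zero^'n^'m \<Rightarrow> 'a^'q^'p \<Rightarrow> 'a^('n + 'q)^('m + 'p)" where
  "direct_sum A D = (\<chi> i j. case (i, j) of
      (Inl a, Inl b) \<Rightarrow> A $ a $ b | (Inr a, Inr b) \<Rightarrow> D $ a $ b | _ \<Rightarrow> 0)"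

text \<open>A partition \<open>n = n\<^sub>1 + n\<^sub>2\<close> of the indices is rendered by the index type \<open>'n1 + 'n2\<close>;
  the first subscript selects the rows.\<close>

definition block11 :: "'a^('n1::finite + 'n2::finite)^('n1 + 'n2) \<Rightarrow> 'a^'n1^'n1" where
  "block11 M = (\<chi> i j. M $ Inl i $ Inl j)"

definition block12 :: "'a^('n1::finite + 'n2::finite)^('n1 + 'n2) \<Rightarrow> 'a^'n2^'n1" where
  "block12 M = (\<chi> i j. M $ Inl i $ Inr j)"

definition block21 :: "'a^('n1::finite + 'n2::finite)^('n1 + 'n2) \<Rightarrow> 'a^'n1^'n2" where
  "block21 M = (\<chi> i j. M $ Inr i $ Inl j)"

definition block22 :: "'a^('n1::finite + 'n2::finite)^('n1 + 'n2) \<Rightarrow> 'a^'n2^'n2" where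
  "block22 M = (\<chi> i j. M $ Inr i $ Inr j)"

definition schur_complement :: "real^('n1::finite + 'n2::finite)^('n1 + 'n2) \<Rightarrow> real^'n1^'n1" where
  "schur_complement M = block11 M - block12 M ** matrix_inv (block22 M) ** block21 M"


section \<open>The ac network\<close>

text \<open>The nodes of the network are the inverter nodes \<open>Inl i\<close> and further nodes \<open>Inr r\<close>; among
  the latter, a set \<open>G\<close> consists of the infinite (grounded) nodes, and the others are interior.
  The susceptance of the line between \<open>u\<close> and \<open>v\<close> is \<open>w u v\<close>, with value \<open>0\<close> if there is no line.\<close>

definition ac_network :: "('k + 'r \<Rightarrow> 'k + 'r \<Rightarrow> real) \<Rightarrow> 'r set \<Rightarrow> bool" where
  "ac_network w G \<longleftrightarrow> (\<forall>u v. w u v = w v u) \<and> (\<forall>u v. 0 \<le> w u v) \<and> G \<noteq> {}"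

text \<open>The inverters are coupled through the network itself. A path through an infinite node does not
  couple them, since the voltage of an infinite node is fixed.\<close>

definition inverters_coupled :: "('k + 'r \<Rightarrow> 'k + 'r \<Rightarrow> real) \<Rightarrow> 'r set \<Rightarrow> bool" where
  "inverters_coupled w G \<longleftrightarrow> (\<forall>i j. (Inl i, Inl j) \<in>
      {(u, v). u \<notin> Inr ` G \<and> v \<notin> Inr ` G \<and> w u v > 0}\<^sup>*)"

definition laplacian :: "('v \<Rightarrow> 'v \<Rightarrow> real) \<Rightarrow> real^'v^'v" where
  "laplacian w = (\<chi> u v. if u = v then (\<Sum>x\<in>UNIV - {u}. w u x) else - w u v)"

text \<open>Grounding the infinite nodes deletes their rows and columns from the Laplacian of the whole
  network. Kron reduction then takes the Schur complement with respect to the interior nodes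
  \<open>- G\<close>. The inverse \<open>X\<close> of the interior block is given by its entries, so that \<open>- G\<close> may be
  empty; its existence is part of the definition.\<close>

definition grounded_laplacian ::
    "('k::finite + 'r::finite \<Rightarrow> 'k + 'r \<Rightarrow> real) \<Rightarrow> 'r set \<Rightarrow> real^'k^'k \<Rightarrow> bool" where
  "grounded_laplacian w G B \<longleftrightarrow> (\<exists>X :: 'r \<Rightarrow> 'r \<Rightarrow> real.
      (\<forall>k \<in> - G. \<forall>l \<in> - G.
         (\<Sum>m \<in> - G. laplacian w $ Inr k $ Inr m * X m l) = (if k = l then 1 else 0)) \<and>
      (\<forall>i j. B $ i $ j = laplacian w $ Inl i $ Inl j
         - (\<Sum>k \<in> - G. \<Sum>l \<in> - G.
              laplacian w $ Inl i $ Inr k * X k l * laplacian w $ Inr l $ Inl j)))"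


section \<open>Admittances\<close>

definition F_net :: "real \<Rightarrow> complex \<Rightarrow> complex^2^2" where
  "F_net \<omega>\<^sub>0 s = map_matrix ((*) (1 / (s\<^sup>2 / of_real \<omega>\<^sub>0 + of_real \<omega>\<^sub>0)))
     (vector [vector [s, of_real \<omega>\<^sub>0],
              vector [- of_real \<omega>\<^sub>0, s]])"

abbreviation cmat :: "real^'n^'m \<Rightarrow> complex^'n^'m" where
  "cmat A \<equiv> map_matrix complex_of_real A"

text \<open>In the next two definitions, \<open>Fs\<close> and \<open>Y\<close> are the values of \<open>F_net\<close> and of the GFM
  admittance at one complex frequency.\<close>

definition gfm_side_admittance ::
    "real^('n1::finite + 'n2::finite)^('n1 + 'n2) \<Rightarrow> complex^2^2 \<Rightarrow> complex^2^2 \<Rightarrow> complex^('n2 \<times> 2)^('n2 \<times> 2)" where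
  "gfm_side_admittance B Fs Y = cmat (block22 B) \<otimes>\<^sub>K Fs + mat 1 \<otimes>\<^sub>K Y"

definition sub1_admittance ::
    "real^('n1::finite + 'n2::finite)^('n1 + 'n2) \<Rightarrow> complex^2^2 \<Rightarrow> complex^2^2 \<Rightarrow> complex^('n1 \<times> 2)^('n1 \<times> 2)" where
  "sub1_admittance B Fs Y = cmat (block11 B) \<otimes>\<^sub>K Fs
     - (cmat (block12 B) \<otimes>\<^sub>K Fs) ** matrix_inv (gfm_side_admittance B Fs Y)
       ** (cmat (block21 B) \<otimes>\<^sub>K Fs)"

definition B_mod :: "real^('n1::finite + 'n2::finite)^('n1 + 'n2) \<Rightarrow> real \<Rightarrow> real^('n1 + 'n2)^('n1 + 'n2)" where
  "B_mod B B_eq = B + direct_sum 0 (B_eq *\<^sub>R mat 1)"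

end

theory Submission
  imports Defs
begin

text \<open>Part (a) is the mixed-product rule for Kronecker products. For (b), let \<open>v\<close> be an eigenvector of the
  Schur complement for its smallest eigenvalue \<open>\<mu>\<close>, and extend it to \<open>x = (v, y)\<close> such that the second
  block of \<open>B\<^sub>m\<^sub>o\<^sub>d x\<close> vanishes. Then \<open>x \<bullet> B x = \<mu> \<parallel>v\<parallel>\<^sup>2 - B\<^sub>e\<^sub>q \<parallel>y\<parallel>\<^sup>2\<close>, so the inequality is strict if
  \<open>y \<noteq> 0\<close>. If \<open>y = 0\<close>, equality would make \<open>x\<close> an eigenvector for the smallest eigenvalue of \<open>B\<close> with zero
  entries, which Perron-Frobenius excludes for a connected network.\<close>

section \<open>Smallest eigenvalues of symmetric matrices\<close>

lemma sum_UNIV_Plus: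
  fixes f :: "'a::finite + 'b::finite \<Rightarrow> 'c::comm_monoid_add"
  shows "(\<Sum>i\<in>UNIV. f i) = (\<Sum>a\<in>UNIV. f (Inl a)) + (\<Sum>b\<in>UNIV. f (Inr b))"
  by (simp add: UNIV_Plus_UNIV[symmetric] sum.Plus del: UNIV_Plus_UNIV)

text \<open>The quadratic vanishes at \<open>t = 0\<close> and is nonnegative, so \<open>0\<close>
  is a minimum and the derivative \<open>2 * a\<close> there is zero.\<close>

lemma linear_quadratic_nonneg_imp_zero:
  fixes a b :: real
  assumes "\<And>t. 0 \<le> 2 * t * a + t\<^sup>2 * b"
  shows "a = 0"
proof (rule ccontr)
  assume "a \<noteq> 0"
  \<comment> \<open>The \<open>+ 1\<close> keeps the denominator positive when \<open>b = 0\<close>;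
    with this step length the quadratic term undoes at most half of the linear decrease.\<close>
  define t where "t = - a / (\<bar>b\<bar> + 1)"
  have "t\<^sup>2 * b \<le> t\<^sup>2 * (\<bar>b\<bar> + 1)"
    by (intro mult_left_mono) auto
  also have "\<dots> = - t * a"
    by (simp add: t_def power2_eq_square)
  finally have "0 \<le> t * a"
    using assms[of t] by simp
  moreover have "t * a = - (a\<^sup>2 / (\<bar>b\<bar> + 1))"
    by (simp add: t_def power2_eq_square)
  moreover have "a\<^sup>2 / (\<bar>b\<bar> + 1) > 0"
    using \<open>a \<noteq> 0\<close> by simp
  ultimately show False
    by simp
qed

text \<open>First-order condition: a null vector of a form that is nonnegative on \<open>V\<close>
  minimises it there, so the variation in every direction of \<open>V\<close> vanishes. With
  \<open>V = UNIV\<close> it yields eigenvectors, with a proper subspace Euler-Lagrange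
  equations.\<close>

lemma psd_form_null_imp_orthogonal:
  fixes f :: "'a::real_inner \<Rightarrow> 'a"
  assumes "linear f" and sym: "\<And>x y. x \<bullet> f y = f x \<bullet> y"
    and "subspace V" and nonneg: "\<And>x. x \<in> V \<Longrightarrow> 0 \<le> x \<bullet> f x"
    and "v \<in> V" "v \<bullet> f v = 0" "u \<in> V"
  shows "u \<bullet> f v = 0"
proof (rule linear_quadratic_nonneg_imp_zero)
  fix t :: real
  have "v + t *\<^sub>R u \<in> V"
    using assms by (simp add: subspace_add subspace_scale)
  then have "0 \<le> (v + t *\<^sub>R u) \<bullet> f (v + t *\<^sub>R u)"
    by (rule nonneg)
  also have "\<dots> = v \<bullet> f v + t * (v \<bullet> f u) + t * (u \<bullet> f v) + t\<^sup>2 * (u \<bullet> f u)"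
    by (simp add: linear_add[OF \<open>linear f\<close>] linear_scale[OF \<open>linear f\<close>] inner_add_left
        inner_add_right algebra_simps power2_eq_square)
  also have "v \<bullet> f u = u \<bullet> f v"
    using sym[of v u] by (simp add: inner_commute)
  finally show "0 \<le> 2 * t * (u \<bullet> f v) + t\<^sup>2 * (u \<bullet> f u)"
    using \<open>v \<bullet> f v = 0\<close> by simp
qed

section \<open>Spectrum and Rayleigh quotient of a symmetric matrix\<close>

lemma transpose_eq_imp_inner_sym:
  fixes A :: "real^'n^'n"
  assumes "transpose A = A"
  shows "x \<bullet> (A *v y) = (A *v x) \<bullet> y"
  using assms by (metis dot_lmul_matrix transpose_matrix_vector)

context
  fixes A :: "real^'n::finite^'n"
  assumes sym: "\<And>x y. x \<bullet> (A *v y) = (A *v x) \<bullet> y"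
begin

text \<open>Eigenvectors for distinct eigenvalues are orthogonal, hence independent, and choosing
  one for each eigenvalue is injective. Finiteness gives the \<open>Min\<close> in
  \<open>smallest_eigenvalue\<close> its meaning.\<close>

lemma finite_eigenvalues_sym: "finite {c. eigenvalue A c}"
proof -
  define e where "e c = (SOME v. v \<noteq> 0 \<and> A *v v = c *\<^sub>R v)" for c
  let ?E = "{c. eigenvalue A c}"
  have e: "e c \<noteq> 0 \<and> A *v e c = c *\<^sub>R e c" if "c \<in> ?E" for c
    using that unfolding e_def eigenvalue_def mem_Collect_eq by (rule someI_ex)
  have inj: "inj_on e ?E"
  proof (rule inj_onI)
    fix c d assume "c \<in> ?E" "d \<in> ?E" "e c = e d"
    then have "c *\<^sub>R e c = d *\<^sub>R e c" "e c \<noteq> 0"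
      using e by metis+
    then show "c = d"
      by simp
  qed
  have "e c \<bullet> e d = 0" if "c \<in> ?E" "d \<in> ?E" "c \<noteq> d" for c d
    using sym[of "e c" "e d"] e[OF that(1)] e[OF that(2)] that(3) by simp
  then have "pairwise orthogonal (e ` ?E)"
    by (auto simp: pairwise_def orthogonal_def)
  moreover have "0 \<notin> e ` ?E"
    using e by force
  ultimately have "finite (e ` ?E)"
    using pairwise_orthogonal_independent independent_imp_finite by blast
  then show ?thesis
    using inj by (simp add: finite_image_iff)
qed

text \<open>By compactness the form attains a minimum \<open>m\<close> on the unit sphere. The form
  of \<open>A\<close> minus \<open>m\<close> times the identity is then nonnegative and null at the
  minimiser, which is therefore an eigenvector.\<close>

lemma exists_minimal_eigenvalue:
  "\<exists>m. eigenvalue A m \<and> (\<forall>x. m * (x \<bullet> x) \<le> x \<bullet> (A *v x))"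
proof -
  have "continuous_on (sphere 0 1) (\<lambda>x. x \<bullet> (A *v x))"
    by (intro continuous_on_inner continuous_on_id matrix_vector_mult_linear_continuous_on)
  moreover have "sphere (0::real^'n) 1 \<noteq> {}"
    by simp
  ultimately obtain v where "v \<in> sphere 0 1"
    and min: "\<And>x. x \<in> sphere 0 1 \<Longrightarrow> v \<bullet> (A *v v) \<le> x \<bullet> (A *v x)"
    using continuous_attains_inf[OF compact_sphere] by blast
  then have v: "v \<bullet> v = 1" "v \<noteq> 0"
    by (auto simp: dot_square_norm)
  define m where "m = v \<bullet> (A *v v)"
  have rayleigh: "m * (x \<bullet> x) \<le> x \<bullet> (A *v x)" for x
  proof (cases "x = 0")
    case False
    define y where "y = (1 / norm x) *\<^sub>R x"
    have x: "x = norm x *\<^sub>R y"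
      using False by (simp add: y_def)
    have "m \<le> y \<bullet> (A *v y)"
      unfolding m_def using False by (intro min) (simp add: y_def)
    then have "(norm x)\<^sup>2 * m \<le> (norm x)\<^sup>2 * (y \<bullet> (A *v y))"
      by (intro mult_left_mono) auto
    also have "\<dots> = x \<bullet> (A *v x)"
      by (subst (2 3) x) (simp add: matrix_vector_mult_scaleR power2_eq_square)
    finally show ?thesis
      by (simp add: dot_square_norm mult.commute)
  qed simp
  let ?f = "\<lambda>x. A *v x - m *\<^sub>R x"
  have "u \<bullet> ?f v = 0" for u
  proof (rule psd_form_null_imp_orthogonal[where f = ?f and V = UNIV])
    show "linear ?f"
      by (intro linear_compose_sub matrix_vector_mul_linear linear_scale_self)
    show "x \<bullet> ?f y = ?f x \<bullet> y" for x y
      using sym[of x y] by (simp add: inner_diff_left inner_diff_right)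
    show "0 \<le> x \<bullet> ?f x" for x
      using rayleigh[of x] by (simp add: inner_diff_right)
    show "v \<bullet> ?f v = 0"
      using v by (simp add: inner_diff_right m_def)
  qed auto
  then have "?f v = 0"
    using inner_eq_zero_iff by blast
  then have "eigenvalue A m"
    unfolding eigenvalue_def using v(2) by auto
  then show ?thesis
    using rayleigh by blast
qed

lemma
  shows eigenvalue_smallest_eigenvalue: "eigenvalue A (smallest_eigenvalue A)"
    and smallest_eigenvalue_le_form: "smallest_eigenvalue A * (x \<bullet> x) \<le> x \<bullet> (A *v x)"
proof -
  obtain m where m: "eigenvalue A m" "\<And>x. m * (x \<bullet> x) \<le> x \<bullet> (A *v x)"
    using exists_minimal_eigenvalue by blast
  have "m \<le> c" if "eigenvalue A c" for c
  proof -
    obtain v where "v \<noteq> 0" "A *v v = c *\<^sub>R v"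
      using \<open>eigenvalue A c\<close> unfolding eigenvalue_def by blast
    then show ?thesis
      using m(2)[of v] by simp
  qed
  then have "smallest_eigenvalue A = m"
    unfolding smallest_eigenvalue_def using m(1) finite_eigenvalues_sym by (intro Min_eqI) auto
  with m show "eigenvalue A (smallest_eigenvalue A)"
    and "smallest_eigenvalue A * (x \<bullet> x) \<le> x \<bullet> (A *v x)"
    by auto
qed

end


section \<open>Positivity of the ground state of a grounded Laplacian\<close>

lemma laplacian_mult_vec_nth:
  "(laplacian w *v z) $ u = (\<Sum>v\<in>UNIV. w u v * (z $ u - z $ v))"
proof -
  have "(laplacian w *v z) $ u =
      (\<Sum>x\<in>UNIV - {u}. w u x) * z $ u + (\<Sum>v\<in>UNIV - {u}. - w u v * z $ v)"
    unfolding laplacian_def matrix_vector_mult_def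
    by (simp add: sum.remove[of UNIV u] cong: if_cong)
  also have "\<dots> = (\<Sum>v\<in>UNIV - {u}. w u v * (z $ u - z $ v))"
    by (simp add: sum_distrib_right right_diff_distrib sum_subtractf sum_negf)
  \<comment> \<open>The summand for \<open>v = u\<close> is zero whatever \<open>w u u\<close>
    is.\<close>
  also have "\<dots> = (\<Sum>v\<in>UNIV. w u v * (z $ u - z $ v))"
    by (simp add: sum.remove[of UNIV u])
  finally show ?thesis .
qed

text \<open>Averaging the double sum with its copy under exchange of \<open>u\<close> and
  \<open>v\<close> gives the Dirichlet energy; the division by 2 compensates for counting each line
  in both directions.\<close>

lemma laplacian_form:
  assumes "\<And>u v. w u v = w v u"
  shows "x \<bullet> (laplacian w *v y) =
    (\<Sum>u\<in>UNIV. \<Sum>v\<in>UNIV. w u v * (x $ u - x $ v) * (y $ u - y $ v)) / 2"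
proof -
  let ?g = "\<lambda>u v. w u v * x $ u * (y $ u - y $ v)"
  have 1: "x \<bullet> (laplacian w *v y) = (\<Sum>u\<in>UNIV. \<Sum>v\<in>UNIV. ?g u v)"
    by (simp add: inner_vec_def laplacian_mult_vec_nth sum_distrib_left mult_ac)
  also have "\<dots> = (\<Sum>u\<in>UNIV. \<Sum>v\<in>UNIV. ?g v u)"
    by (rule sum.swap)
  finally have 2: "x \<bullet> (laplacian w *v y) = (\<Sum>u\<in>UNIV. \<Sum>v\<in>UNIV. ?g v u)" .
  have "?g u v + ?g v u = w u v * (x $ u - x $ v) * (y $ u - y $ v)" for u v
    using assms[of u v] by (simp add: algebra_simps)
  then have "(\<Sum>u\<in>UNIV. \<Sum>v\<in>UNIV. ?g u v) + (\<Sum>u\<in>UNIV. \<Sum>v\<in>UNIV. ?g v u) =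
      (\<Sum>u\<in>UNIV. \<Sum>v\<in>UNIV. w u v * (x $ u - x $ v) * (y $ u - y $ v))"
    by (simp add: sum.distrib[symmetric])
  then show ?thesis
    using 1 2 by simp
qed

lemma laplacian_inner_sym:
  assumes "\<And>u v. w u v = w v u"
  shows "x \<bullet> (laplacian w *v y) = (laplacian w *v x) \<bullet> y"
  by (simp add: inner_commute[of _ y] laplacian_form[OF assms] mult_ac)

text \<open>Kron reduction as a Dirichlet problem: \<open>z\<close> has potentials \<open>x\<close>
  at the inverters and \<open>0\<close> at the infinite nodes, and the right inverse
  \<open>X\<close> solves for the interior potentials that make the interior currents vanish. The
  currents at the inverters are then \<open>B *v x\<close>.\<close>

lemma kron_harmonic_extension:
  fixes w :: "'k::finite + 'r::finite \<Rightarrow> 'k + 'r \<Rightarrow> real"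
  assumes "grounded_laplacian w G B"
  obtains z where "\<And>i. z $ Inl i = x $ i" "\<And>g. g \<in> G \<Longrightarrow> z $ Inr g = 0"
    "\<And>m. m \<notin> G \<Longrightarrow> (laplacian w *v z) $ Inr m = 0"
    "\<And>i. (laplacian w *v z) $ Inl i = (B *v x) $ i"
proof -
  let ?L = "\<lambda>u v. laplacian w $ u $ v"
  obtain X where X: "\<And>k l. k \<in> - G \<Longrightarrow> l \<in> - G \<Longrightarrow>
        (\<Sum>m \<in> - G. ?L (Inr k) (Inr m) * X m l) = (if k = l then 1 else 0)"
    and B: "\<And>i j. B $ i $ j = ?L (Inl i) (Inl j)
         - (\<Sum>k \<in> - G. \<Sum>l \<in> - G. ?L (Inl i) (Inr k) * X k l * ?L (Inr l) (Inl j))"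
    using assms unfolding grounded_laplacian_def by blast
  define b where "b l = (\<Sum>j\<in>UNIV. ?L (Inr l) (Inl j) * x $ j)" for l
  define y where "y k = - (\<Sum>l \<in> - G. X k l * b l)" for k
  define z :: "real^('k + 'r)"
    where "z = (\<chi> u. case u of Inl i \<Rightarrow> x $ i | Inr k \<Rightarrow> if k \<in> G then 0 else y k)"
  have Lz: "(laplacian w *v z) $ u =
      (\<Sum>j\<in>UNIV. ?L u (Inl j) * x $ j) + (\<Sum>k\<in>-G. ?L u (Inr k) * y k)" for u
  proof -
    have "(\<Sum>k\<in>UNIV. ?L u (Inr k) * z $ Inr k) = (\<Sum>k\<in>-G. ?L u (Inr k) * y k)"
      by (rule sum.mono_neutral_cong_right) (auto simp: z_def)
    then show ?thesis
      by (simp add: matrix_vector_mult_def sum_UNIV_Plus) (simp add: z_def)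
  qed
  show thesis
  proof
    show "z $ Inl i = x $ i" for i
      by (simp add: z_def)
    show "z $ Inr g = 0" if "g \<in> G" for g
      using that by (simp add: z_def)
    show "(laplacian w *v z) $ Inr m = 0" if "m \<notin> G" for m
    proof -
      have "(\<Sum>k\<in>-G. ?L (Inr m) (Inr k) * y k) =
          - (\<Sum>k\<in>-G. \<Sum>l\<in>-G. ?L (Inr m) (Inr k) * X k l * b l)"
        by (simp add: y_def sum_distrib_left sum_negf mult.assoc)
      also have "\<dots> = - (\<Sum>l\<in>-G. \<Sum>k\<in>-G. ?L (Inr m) (Inr k) * X k l * b l)"
        by (subst sum.swap) simp
      also have "\<dots> = - (\<Sum>l\<in>-G. (if m = l then 1 else 0) * b l)"
        using that by (simp add: sum_distrib_right[symmetric] X)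
      also have "\<dots> = - b m"
        using that by (simp add: if_distrib[of "\<lambda>c. c * _"] cong: if_cong)
      finally show ?thesis
        by (simp add: Lz b_def)
    qed
    show "(laplacian w *v z) $ Inl i = (B *v x) $ i" for i
    proof -
      have "(\<Sum>j\<in>UNIV. (\<Sum>k\<in>-G. \<Sum>l\<in>-G. ?L (Inl i) (Inr k) * X k l * ?L (Inr l) (Inl j)) * x $ j)
          = (\<Sum>k\<in>-G. \<Sum>l\<in>-G. \<Sum>j\<in>UNIV. ?L (Inl i) (Inr k) * X k l * ?L (Inr l) (Inl j) * x $ j)"
        \<comment> \<open>Two exchanges carry the sum over \<open>j\<close> inside both interior
          sums.\<close>
        unfolding sum_distrib_right by (subst sum.swap, intro sum.cong refl, rule sum.swap)
      also have "\<dots> = - (\<Sum>k\<in>-G. ?L (Inl i) (Inr k) * y k)"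
        by (simp add: y_def b_def sum_distrib_left sum_negf mult.assoc)
      finally show ?thesis
        by (subst Lz) (simp add: matrix_vector_mult_def B left_diff_distrib sum_subtractf)
    qed
  qed
qed

text \<open>Dirichlet principle. The deviation \<open>d\<close> of \<open>z\<close> from the
  harmonic extension \<open>h\<close> is zero at inverters and infinite nodes, while the current of
  \<open>h\<close> is zero at interior nodes. The cross terms vanish, leaving the nonnegative energy
  of \<open>d\<close> as the excess.\<close>

lemma kron_form_le_laplacian_form:
  fixes w :: "'k::finite + 'r::finite \<Rightarrow> 'k + 'r \<Rightarrow> real"
  assumes "ac_network w G" "grounded_laplacian w G B"
    and x: "\<And>i. z $ Inl i = x $ i" and G: "\<And>g. g \<in> G \<Longrightarrow> z $ Inr g = 0"
  shows "x \<bullet> (B *v x) \<le> z \<bullet> (laplacian w *v z)"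
proof -
  have wsym: "w u v = w v u" and wnn: "0 \<le> w u v" for u v
    using assms(1) by (auto simp: ac_network_def)
  obtain h where h: "\<And>i. h $ Inl i = x $ i" "\<And>g. g \<in> G \<Longrightarrow> h $ Inr g = 0"
    "\<And>m. m \<notin> G \<Longrightarrow> (laplacian w *v h) $ Inr m = 0"
    "\<And>i. (laplacian w *v h) $ Inl i = (B *v x) $ i"
    using kron_harmonic_extension[OF assms(2)] by metis
  define d where "d = z - h"
  have "h $ Inr k * (laplacian w *v h) $ Inr k = 0" for k
    using h by (cases "k \<in> G") auto
  then have "(\<Sum>k\<in>UNIV. h $ Inr k * (laplacian w *v h) $ Inr k) = 0"
    by (intro sum.neutral ballI)
  then have hh: "h \<bullet> (laplacian w *v h) = x \<bullet> (B *v x)"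
    by (simp add: inner_vec_def sum_UNIV_Plus h)
  have "d $ Inr k * (laplacian w *v h) $ Inr k = 0" for k
    using h G by (cases "k \<in> G") (auto simp: d_def)
  then have "(\<Sum>k\<in>UNIV. d $ Inr k * (laplacian w *v h) $ Inr k) = 0"
    by (intro sum.neutral ballI)
  then have dh: "d \<bullet> (laplacian w *v h) = 0"
    by (simp add: inner_vec_def sum_UNIV_Plus h) (simp add: d_def x h)
  then have hd: "h \<bullet> (laplacian w *v d) = 0"
    using laplacian_inner_sym[OF wsym, where x = h and y = d] by (simp add: inner_commute)
  have "0 \<le> d \<bullet> (laplacian w *v d)"
    unfolding laplacian_form[OF wsym] by (auto intro!: sum_nonneg simp: wnn mult.assoc)
  moreover have "z = h + d"
    by (simp add: d_def)
  then have "z \<bullet> (laplacian w *v z) = x \<bullet> (B *v x) + d \<bullet> (laplacian w *v d)"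
    by (simp add: matrix_vector_right_distrib inner_add_left inner_add_right hh dh hd)
  ultimately show ?thesis
    by simp
qed

text \<open>The reverse triangle inequality, applied line by line with nonnegative weights.\<close>

lemma laplacian_form_abs_le:
  assumes "ac_network w G"
  shows "(\<chi> u. \<bar>z $ u\<bar>) \<bullet> (laplacian w *v (\<chi> u. \<bar>z $ u\<bar>)) \<le> z \<bullet> (laplacian w *v z)"
proof -
  have wsym: "w u v = w v u" and wnn: "0 \<le> w u v" for u v
    using assms by (auto simp: ac_network_def)
  have "(\<bar>z $ u\<bar> - \<bar>z $ v\<bar>) * (\<bar>z $ u\<bar> - \<bar>z $ v\<bar>) \<le> (z $ u - z $ v) * (z $ u - z $ v)" for u v
    by (rule abs_le_square_iff[THEN iffD1, unfolded power2_eq_square]) simp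
  then show ?thesis
    unfolding laplacian_form[OF wsym]
    by (auto intro!: sum_mono divide_right_mono mult_left_mono simp: wnn mult.assoc)
qed

text \<open>Lifting to the unreduced network makes the Perron-Frobenius argument elementary: if the
  harmonic extension \<open>h\<close> of \<open>x\<close> minimises the energy minus \<open>\<kappa>\<close> times the squared norm on the
  inverter nodes, then so does its absolute value, and the Euler-Lagrange equations of the latter
  propagate a zero along every line between ungrounded nodes.\<close>

lemma smallest_eigenvector_nonzero:
  fixes w :: "'k::finite + 'r::finite \<Rightarrow> 'k + 'r \<Rightarrow> real"
  assumes net: "ac_network w G" and coupled: "inverters_coupled w G"
    and kron: "grounded_laplacian w G B"
    and le: "\<And>y. \<kappa> * (y \<bullet> y) \<le> y \<bullet> (B *v y)"
    and eig: "B *v x = \<kappa> *\<^sub>R x" and "x \<noteq> 0"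
  shows "x $ j \<noteq> 0"
proof
  assume "x $ j = 0"
  have wsym: "w u v = w v u" and wnn: "0 \<le> w u v" for u v
    using net by (auto simp: ac_network_def)
  \<comment> \<open>\<open>p\<close> and \<open>r\<close> both keep the inverter entries,
    \<open>p\<close> padding them with zeros. The map \<open>f\<close> is half the gradient of the
    energy minus \<open>\<kappa>\<close> times the squared norm on the inverters, and
    \<open>V\<close> holds the potentials that vanish at the infinite nodes.\<close>
  define p :: "real^('k + 'r) \<Rightarrow> real^('k + 'r)"
    where "p z = (\<chi> u. case u of Inl i \<Rightarrow> z $ Inl i | Inr _ \<Rightarrow> 0)" for z
  define r :: "real^('k + 'r) \<Rightarrow> real^'k" where "r z = (\<chi> i. z $ Inl i)" for z
  define V :: "(real^('k + 'r)) set" where "V = {z. \<forall>g\<in>G. z $ Inr g = 0}"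
  define f where "f z = laplacian w *v z - \<kappa> *\<^sub>R p z" for z
  have p_inner: "y \<bullet> p z = r y \<bullet> r z" for y z
    by (simp add: inner_vec_def sum_UNIV_Plus p_def r_def)
  have "linear p"
    by (rule linearI) (auto simp: p_def vec_eq_iff split: sum.split)
  then have "linear f"
    unfolding f_def
    by (intro linear_compose_sub matrix_vector_mul_linear linear_compose_scale_right)
  have f_sym: "y \<bullet> f z = f y \<bullet> z" for y z
    by (simp add: f_def inner_diff_left inner_diff_right laplacian_inner_sym[OF wsym] p_inner
        inner_commute[of "p y"] inner_commute[of "r z"])
  have f_form: "z \<bullet> f z = z \<bullet> (laplacian w *v z) - \<kappa> * (r z \<bullet> r z)" for z
    by (simp add: f_def inner_diff_right p_inner)
  have "subspace V"
    by (auto simp: V_def subspace_def)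
  \<comment> \<open>The Dirichlet principle reduces this to the Rayleigh bound for
    \<open>B\<close>.\<close>
  have nonneg: "0 \<le> z \<bullet> f z" if "z \<in> V" for z
  proof -
    have "r z \<bullet> (B *v r z) \<le> z \<bullet> (laplacian w *v z)"
      using that by (intro kron_form_le_laplacian_form[OF net kron]) (auto simp: r_def V_def)
    with le[of "r z"] show ?thesis
      by (simp add: f_form)
  qed
  obtain h where h: "\<And>i. h $ Inl i = x $ i" "\<And>g. g \<in> G \<Longrightarrow> h $ Inr g = 0"
    "\<And>m. m \<notin> G \<Longrightarrow> (laplacian w *v h) $ Inr m = 0"
    "\<And>i. (laplacian w *v h) $ Inl i = (B *v x) $ i"
    using kron_harmonic_extension[OF kron] by metis
  have "h $ Inr k * (laplacian w *v h) $ Inr k = 0" for k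
    using h by (cases "k \<in> G") auto
  then have "(\<Sum>k\<in>UNIV. h $ Inr k * (laplacian w *v h) $ Inr k) = 0"
    by (intro sum.neutral ballI)
  \<comment> \<open>Infinite and interior nodes contribute nothing: the potential vanishes at the
    former and the current at the latter.\<close>
  then have h_form: "h \<bullet> (laplacian w *v h) = \<kappa> * (x \<bullet> x)"
    by (simp add: inner_vec_def sum_UNIV_Plus h eig sum_distrib_left mult_ac)
  define a where "a = (\<chi> u. \<bar>h $ u\<bar>)"
  have "a \<in> V"
    by (auto simp: V_def a_def h)
  have "r a \<bullet> r a = x \<bullet> x"
    by (simp add: r_def a_def h inner_vec_def)
  then have "a \<bullet> f a \<le> 0"
    using laplacian_form_abs_le[OF net, of h] by (simp add: f_form h_form a_def)
  then have a_null: "a \<bullet> f a = 0"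
    using nonneg[OF \<open>a \<in> V\<close>] by simp
  \<comment> \<open>The unit vector at an ungrounded node lies in \<open>V\<close>, so it is an
    admissible direction of variation.\<close>
  have f_a: "f a $ u = 0" if "u \<notin> Inr ` G" for u
  proof -
    have "axis u 1 \<in> V"
      using that by (auto simp: V_def axis_def)
    then have "axis u 1 \<bullet> f a = 0"
      using psd_form_null_imp_orthogonal[OF \<open>linear f\<close> f_sym \<open>subspace V\<close> nonneg \<open>a \<in> V\<close> a_null]
      by blast
    then show ?thesis
      by (simp add: inner_axis')
  qed
  \<comment> \<open>At a zero of \<open>a\<close> the \<open>\<kappa>\<close> term drops out, so the
    weighted neighbour values sum to zero; being nonnegative, each of them is zero.\<close>
  have propagate: "a $ v = 0" if "a $ u = 0" "u \<notin> Inr ` G" "w u v > 0" for u v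
  proof -
    have "p a $ u = 0"
      using that by (auto simp: p_def split: sum.split)
    then have "(laplacian w *v a) $ u = 0"
      using f_a[OF that(2)] by (simp add: f_def)
    then have "(\<Sum>v\<in>UNIV. w u v * a $ v) = 0"
      using that by (simp add: laplacian_mult_vec_nth sum_negf)
    moreover have "0 \<le> w u v * a $ v" for v
      by (simp add: wnn a_def)
    ultimately have "w u v * a $ v = 0"
      by (simp add: sum_nonneg_eq_0_iff)
    then show ?thesis
      using that by simp
  qed
  have "x $ i = 0" for i
  proof -
    have "(Inl j, Inl i) \<in> {(u, v). u \<notin> Inr ` G \<and> v \<notin> Inr ` G \<and> w u v > 0}\<^sup>*"
      using coupled by (simp add: inverters_coupled_def)
    then have "a $ Inl i = 0"
    proof (induction rule: rtrancl_induct)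
      case base
      then show ?case
        using \<open>x $ j = 0\<close> by (simp add: a_def h)
    next
      case (step u v)
      then show ?case
        using propagate by blast
    qed
    then show ?thesis
      by (simp add: a_def h)
  qed
  then show False
    using \<open>x \<noteq> 0\<close> by (simp add: vec_eq_iff)
qed


section \<open>The modified Schur complement\<close>

lemma matrix_inv_mult:
  assumes "invertible A"
  shows "A ** matrix_inv A = mat 1" "matrix_inv A ** A = mat 1"
  using someI_ex[OF assms[unfolded invertible_def]] by (simp_all add: matrix_inv_def)

lemma matrix_inv_eqI:
  fixes A :: "'a::semiring_1^'n^'n"
  assumes "A ** X = mat 1" "X ** A = mat 1"
  shows "invertible A" "matrix_inv A = X"
proof -
  show "invertible A"
    unfolding invertible_def using assms by blast
  then have "matrix_inv A ** (A ** X) = X"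
    by (simp add: matrix_mul_assoc matrix_inv_mult)
  then show "matrix_inv A = X"
    by (simp add: assms)
qed

lemma blocks_B_mod:
  "block11 (B_mod B c) = block11 B" "block12 (B_mod B c) = block12 B"
  "block21 (B_mod B c) = block21 B" "block22 (B_mod B c) = block22 B + c *\<^sub>R mat 1"
  by (simp_all add: B_mod_def direct_sum_def block11_def block12_def block21_def block22_def
      vec_eq_iff)

lemma sym_pos_def_B_mod:
  assumes "sym_pos_def B" "c > 0"
  shows "sym_pos_def (B_mod B c)"
proof -
  have "transpose (B_mod B c) = B_mod B c"
    using assms(1)
    by (auto simp: B_mod_def sym_pos_def_def vec_eq_iff transpose_def direct_sum_def mat_def
        split: sum.split)
  moreover have "x \<bullet> (B_mod B c *v x) > 0" if "x \<noteq> 0" for x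
  proof -
    have "x \<bullet> (direct_sum 0 (c *\<^sub>R mat 1) *v x) = (\<Sum>i\<in>UNIV. c * (x $ Inr i)\<^sup>2)"
      by (simp add: inner_vec_def matrix_vector_mult_def sum_UNIV_Plus direct_sum_def mat_def
          if_distrib[of "\<lambda>d. d * _"] if_distrib[of "\<lambda>d. _ * d"] power2_eq_square mult_ac cong: if_cong)
    also have "\<dots> \<ge> 0"
      using assms(2) by (simp add: sum_nonneg)
    finally show ?thesis
      using assms(1) that by (auto simp: B_mod_def sym_pos_def_def matrix_vector_mult_add_rdistrib
          inner_add_right add_pos_nonneg)
  qed
  ultimately show ?thesis
    by (simp add: sym_pos_def_def)
qed

text \<open>A kernel vector of the block, padded with zeros, would be a null vector of the form of
  \<open>M\<close>.\<close>

lemma sym_pos_def_imp_invertible_block22: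
  fixes M :: "real^('n1::finite + 'n2::finite)^('n1 + 'n2)"
  assumes "sym_pos_def M"
  shows "invertible (block22 M)"
proof -
  have "y = 0" if "block22 M *v y = 0" for y
  proof (rule ccontr)
    assume "y \<noteq> 0"
    define x :: "real^('n1 + 'n2)" where "x = (\<chi> i. case i of Inl _ \<Rightarrow> 0 | Inr b \<Rightarrow> y $ b)"
    have "x $ Inr b = y $ b" for b
      by (simp add: x_def)
    then have "x \<noteq> 0"
      using \<open>y \<noteq> 0\<close> by (metis vec_eq_iff zero_index)
    moreover have "x \<bullet> (M *v x) = y \<bullet> (block22 M *v y)"
      by (simp add: x_def inner_vec_def matrix_vector_mult_def sum_UNIV_Plus block22_def)
    ultimately show False
      using assms that by (fastforce simp: sym_pos_def_def)
  qed
  then show ?thesis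
    by (simp add: invertible_left_inverse matrix_left_invertible_ker)
qed

text \<open>Block elimination: the second part is the solution \<open>y\<close> of
  \<open>block21 M *v v + block22 M *v y = 0\<close>.\<close>

definition schur_extension ::
    "real^('n1::finite + 'n2::finite)^('n1 + 'n2) \<Rightarrow> real^'n1 \<Rightarrow> real^('n1 + 'n2)" where
  "schur_extension M v = (\<chi> i. case i of Inl a \<Rightarrow> v $ a
      | Inr b \<Rightarrow> - (matrix_inv (block22 M) *v (block21 M *v v)) $ b)"

lemma schur_extension_mult:
  fixes M :: "real^('n1::finite + 'n2::finite)^('n1 + 'n2)"
  assumes "invertible (block22 M)"
  shows "(M *v schur_extension M v) $ Inl a = (schur_complement M *v v) $ a"
    and "(M *v schur_extension M v) $ Inr b = 0"
proof -
  define y where "y = matrix_inv (block22 M) *v (block21 M *v v)"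
  have "(M *v schur_extension M v) $ Inl a = (block11 M *v v - block12 M *v y) $ a"
    by (simp add: schur_extension_def matrix_vector_mult_def sum_UNIV_Plus block11_def block12_def
        y_def sum_negf)
  then show "(M *v schur_extension M v) $ Inl a = (schur_complement M *v v) $ a"
    by (simp add: schur_complement_def matrix_vector_mult_diff_rdistrib y_def
        matrix_vector_mul_assoc matrix_mul_assoc)
  have "(M *v schur_extension M v) $ Inr b = (block21 M *v v - block22 M *v y) $ b"
    by (simp add: schur_extension_def matrix_vector_mult_def sum_UNIV_Plus block21_def block22_def
        y_def sum_negf)
  also have "block22 M *v y = block21 M *v v"
    by (simp add: y_def matrix_vector_mul_assoc matrix_mul_assoc matrix_inv_mult[OF assms])
  finally show "(M *v schur_extension M v) $ Inr b = 0"
    by simp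
qed

text \<open>The second block of the image is zero, so only the first blocks pair. This transfers
  symmetry and Rayleigh values between \<open>M\<close> and its Schur complement.\<close>

lemma schur_extension_inner:
  assumes "invertible (block22 M)"
  shows "schur_extension M u \<bullet> (M *v schur_extension M v) = u \<bullet> (schur_complement M *v v)"
  by (simp add: inner_vec_def sum_UNIV_Plus schur_extension_mult[OF assms])
    (simp add: schur_extension_def)

lemma smallest_eigenvalue_schur_complement_gt:
  fixes B :: "real^('n1::finite + 'n2::finite)^('n1 + 'n2)"
    and w :: "('n1 + 'n2) + 'r::finite \<Rightarrow> ('n1 + 'n2) + 'r \<Rightarrow> real"
  assumes net: "ac_network w G" "inverters_coupled w G" "grounded_laplacian w G B"
    and pd: "sym_pos_def B" and "c > 0"
  shows "smallest_eigenvalue B < smallest_eigenvalue (schur_complement (B_mod B c))"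
proof -
  define M where "M = B_mod B c"
  define S where "S = schur_complement M"
  define \<kappa> where "\<kappa> = smallest_eigenvalue B"
  define \<mu> where "\<mu> = smallest_eigenvalue S"
  have M_pd: "sym_pos_def M"
    unfolding M_def using pd \<open>c > 0\<close> by (rule sym_pos_def_B_mod)
  note M22 = sym_pos_def_imp_invertible_block22[OF M_pd]
  have B_sym: "x \<bullet> (B *v y) = (B *v x) \<bullet> y" for x y
    using pd by (simp add: sym_pos_def_def transpose_eq_imp_inner_sym)
  have M_sym: "x \<bullet> (M *v y) = (M *v x) \<bullet> y" for x y
    using M_pd by (simp add: sym_pos_def_def transpose_eq_imp_inner_sym)
  have S_sym: "x \<bullet> (S *v y) = (S *v x) \<bullet> y" for x y
    unfolding S_def using M_sym[of "schur_extension M x" "schur_extension M y"]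
    by (simp add: schur_extension_inner[OF M22] inner_commute[of "M *v _"]
        inner_commute[of "schur_complement M *v _"])
  have "\<kappa> > 0"
  proof -
    obtain v where "v \<noteq> 0" "B *v v = \<kappa> *\<^sub>R v"
      using eigenvalue_smallest_eigenvalue[OF B_sym] unfolding eigenvalue_def \<kappa>_def by blast
    then have "\<kappa> * (v \<bullet> v) > 0"
      using pd by (metis inner_scaleR_right sym_pos_def_def)
    then show ?thesis
      using inner_ge_zero[of v] by (auto simp: zero_less_mult_iff)
  qed
  obtain v where "v \<noteq> 0" and v: "S *v v = \<mu> *\<^sub>R v"
    using eigenvalue_smallest_eigenvalue[OF S_sym] unfolding eigenvalue_def \<mu>_def by blast
  define x where "x = schur_extension M v"
  define y :: "real^'n2" where "y = (\<chi> b. x $ Inr b)"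
  have x_Inl: "x $ Inl a = v $ a" for a
    by (simp add: x_def schur_extension_def)
  have x_norm: "x \<bullet> x = v \<bullet> v + y \<bullet> y"
    by (simp add: inner_vec_def sum_UNIV_Plus x_Inl y_def)
  have Mx: "M *v x = B *v x + direct_sum 0 (c *\<^sub>R mat 1) *v x"
    by (simp add: M_def B_mod_def matrix_vector_mult_add_rdistrib)
  have Dx: "(direct_sum 0 (c *\<^sub>R mat 1) *v x) $ Inl a = 0"
    "(direct_sum 0 (c *\<^sub>R mat 1) *v x) $ Inr b = c * y $ b" for a :: 'n1 and b
    by (simp_all add: matrix_vector_mult_def sum_UNIV_Plus direct_sum_def mat_def y_def
        if_distrib[of "\<lambda>d. d * _"] if_distrib[of "\<lambda>d. _ * d"] cong: if_cong)
  have "x \<bullet> (direct_sum 0 (c *\<^sub>R mat 1) *v x) = c * (y \<bullet> y)"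
    by (simp add: inner_vec_def sum_UNIV_Plus Dx sum_distrib_left mult_ac) (simp add: y_def)
  \<comment> \<open>The form of \<open>M\<close> at \<open>x\<close> is that of \<open>S\<close> at
    \<open>v\<close>, namely \<open>\<mu> * (v \<bullet> v)\<close>; the GFM susceptance accounts
    for the subtracted term.\<close>
  then have "x \<bullet> (B *v x) = \<mu> * (v \<bullet> v) - c * (y \<bullet> y)"
    using schur_extension_inner[OF M22, of v v]
    by (simp add: x_def[symmetric] S_def[symmetric] v Mx inner_add_right)
  then have ineq: "(\<kappa> + c) * (y \<bullet> y) \<le> (\<mu> - \<kappa>) * (v \<bullet> v)"
    using smallest_eigenvalue_le_form[OF B_sym, of x] by (simp add: \<kappa>_def[symmetric] x_norm algebra_simps)
  have "v \<bullet> v > 0"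
    using \<open>v \<noteq> 0\<close> by simp
  have "\<kappa> < \<mu>"
  proof (cases "y = 0")
    case False
    then have "0 < (\<kappa> + c) * (y \<bullet> y)"
      using \<open>\<kappa> > 0\<close> \<open>c > 0\<close> by simp
    with ineq have "0 < (\<mu> - \<kappa>) * (v \<bullet> v)"
      by linarith
    then show ?thesis
      using \<open>v \<bullet> v > 0\<close> by (simp add: zero_less_mult_iff)
  next
    case True
    then have "0 \<le> (\<mu> - \<kappa>) * (v \<bullet> v)"
      using ineq by simp
    then have "\<kappa> \<le> \<mu>"
      using \<open>v \<bullet> v > 0\<close> by (simp add: zero_le_mult_iff)
    moreover have "\<kappa> \<noteq> \<mu>"
    proof
      assume "\<kappa> = \<mu>"
      have x_Inr: "x $ Inr b = 0" for b
        using True by (simp add: y_def vec_eq_iff)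
      \<comment> \<open>For \<open>y = 0\<close> the added diagonal does not act on
        \<open>x\<close>, so \<open>B *v x\<close> agrees with \<open>M *v x\<close>, whose blocks
        are \<open>\<mu> *\<^sub>R v\<close> and zero.\<close>
      have "(B *v x) $ i = (\<kappa> *\<^sub>R x) $ i" for i
      proof -
        have "(M *v x) $ i = (\<mu> *\<^sub>R x) $ i"
          using v schur_extension_mult[OF M22, of v]
          by (cases i) (simp_all add: x_def[symmetric] S_def[symmetric] x_Inl x_Inr)
        moreover have "(direct_sum 0 (c *\<^sub>R mat 1) *v x) $ i = 0"
          using True by (cases i) (simp_all add: Dx)
        ultimately show ?thesis
          by (simp add: Mx \<open>\<kappa> = \<mu>\<close>)
      qed
      then have "B *v x = \<kappa> *\<^sub>R x"
        by (simp add: vec_eq_iff)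
      moreover have "x \<noteq> 0"
        using x_norm True \<open>v \<bullet> v > 0\<close> by auto
      \<comment> \<open>\<open>undefined\<close> merely names some GFM node; there is one because
        index types are nonempty.\<close>
      ultimately have "x $ Inr undefined \<noteq> 0"
        using smallest_eigenvector_nonzero[OF net] smallest_eigenvalue_le_form[OF B_sym]
        unfolding \<kappa>_def by blast
      then show False
        by (simp add: x_Inr)
    qed
    ultimately show ?thesis
      by simp
  qed
  then show ?thesis
    by (simp add: \<kappa>_def \<mu>_def S_def M_def)
qed


section \<open>Kronecker products\<close>

lemma kronecker_mult:
  fixes A :: "'a::comm_semiring_1^'n::finite^'m" and C :: "'a^'q::finite^'p"
  shows "(A \<otimes>\<^sub>K C) ** (A' \<otimes>\<^sub>K C') = (A ** A') \<otimes>\<^sub>K (C ** C')"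
  by (simp add: kronecker_def matrix_matrix_mult_def vec_eq_iff sum_product
      sum.cartesian_product mult_ac split_def)

lemma kronecker_mat_1: "mat 1 \<otimes>\<^sub>K mat 1 = (mat 1 :: 'a::semiring_1^('m::finite \<times> 'n::finite)^('m \<times> 'n))"
  by (auto simp: kronecker_def mat_def vec_eq_iff)

lemma kronecker_add_left: "(A + A') \<otimes>\<^sub>K C = A \<otimes>\<^sub>K C + A' \<otimes>\<^sub>K (C :: 'a::semiring_1^'q^'p)"
  by (simp add: kronecker_def vec_eq_iff distrib_right)

lemma kronecker_diff_left: "(A - A') \<otimes>\<^sub>K C = A \<otimes>\<^sub>K C - A' \<otimes>\<^sub>K (C :: 'a::ring_1^'q^'p)"
  by (simp add: kronecker_def vec_eq_iff left_diff_distrib)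

text \<open>This identifies the GFM term, an identity matrix times \<open>c *\<^sub>R Fs\<close>,
  with a shift of the susceptance block by \<open>c\<close>.\<close>

lemma kronecker_scaleR_left:
  "(c *\<^sub>R A) \<otimes>\<^sub>K C = A \<otimes>\<^sub>K (c *\<^sub>R (C :: 'a::real_algebra_1^'q^'p))"
  by (simp add: kronecker_def vec_eq_iff)

lemma cmat_simps:
  "cmat (A + A') = cmat A + cmat A'" "cmat (A - A') = cmat A - cmat A'"
  "cmat (c *\<^sub>R A) = c *\<^sub>R cmat A" "cmat (A ** D) = cmat A ** cmat D" "cmat (mat 1) = mat 1"
  by (simp_all add: map_matrix_def vec_eq_iff matrix_matrix_mult_def mat_def
      scaleR_conv_of_real[where 'a = complex])

lemma det_F_net: "det (F_net \<omega>\<^sub>0 s) = \<omega>\<^sub>0 / (s\<^sup>2 / \<omega>\<^sub>0 + \<omega>\<^sub>0)" if "\<omega>\<^sub>0 \<noteq> 0"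
proof -
  define d where "d = s\<^sup>2 / complex_of_real \<omega>\<^sub>0 + \<omega>\<^sub>0"
  have "det (F_net \<omega>\<^sub>0 s) = (s\<^sup>2 + (complex_of_real \<omega>\<^sub>0)\<^sup>2) / d\<^sup>2"
    unfolding F_net_def d_def[symmetric] det_2
    by (simp add: map_matrix_def power2_eq_square add_divide_distrib)
  also have "s\<^sup>2 + (complex_of_real \<omega>\<^sub>0)\<^sup>2 = \<omega>\<^sub>0 * d"
    using that by (simp add: d_def distrib_left power2_eq_square)
  finally show ?thesis
    \<comment> \<open>At a pole both sides are \<open>0\<close>, by the convention for division by
      zero.\<close>
    by (cases "d = 0") (simp_all add: d_def[symmetric] power2_eq_square[of d])
qed

text \<open>The GFM side is the Kronecker product of the lower block of \<open>B_mod B c\<close>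
  with \<open>Fs\<close>, so its inverse is the product of the inverses. In the correction term the
  frequency factors collapse to a single \<open>Fs\<close>.\<close>

lemma sub1_admittance_eq_kronecker:
  fixes Fs :: "complex^2^2"
  assumes "invertible (block22 (B_mod B c))" "invertible Fs"
  shows "invertible (gfm_side_admittance B Fs (c *\<^sub>R Fs))"
    and "sub1_admittance B Fs (c *\<^sub>R Fs) = cmat (schur_complement (B_mod B c)) \<otimes>\<^sub>K Fs"
proof -
  let ?M = "block22 (B_mod B c)" and ?X = "gfm_side_admittance B Fs (c *\<^sub>R Fs)"
  let ?Y = "cmat (matrix_inv ?M) \<otimes>\<^sub>K matrix_inv Fs"
  have X: "?X = cmat ?M \<otimes>\<^sub>K Fs"
    by (simp add: gfm_side_admittance_def blocks_B_mod cmat_simps kronecker_add_left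
        kronecker_scaleR_left)
  have "?X ** ?Y = mat 1" "?Y ** ?X = mat 1"
    by (simp_all add: X kronecker_mult cmat_simps(4)[symmetric] matrix_inv_mult[OF assms(1)]
        matrix_inv_mult[OF assms(2)] cmat_simps(5) kronecker_mat_1)
  note inv = matrix_inv_eqI[OF this]
  show "invertible ?X"
    by (fact inv)
  have "Fs ** matrix_inv Fs ** Fs = Fs"
    by (simp add: matrix_inv_mult[OF assms(2)])
  then show "sub1_admittance B Fs (c *\<^sub>R Fs) = cmat (schur_complement (B_mod B c)) \<otimes>\<^sub>K Fs"
    by (simp add: sub1_admittance_def inv(2) kronecker_mult schur_complement_def cmat_simps
        kronecker_diff_left blocks_B_mod)
qed

text \<open>Part (a) is stated at each frequency where \<open>F_net\<close> has a nonzero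
  denominator and the GFM admittance equals its equivalent. The invertibility claims ensure that
  \<open>matrix_inv\<close>, arbitrary on singular matrices, denotes true inverses.\<close>

theorem lemma1:
  fixes B :: "real^('n1::finite + 'n2::finite)^('n1 + 'n2)"
    and w :: "('n1 + 'n2) + 'r::finite \<Rightarrow> ('n1 + 'n2) + 'r \<Rightarrow> real"
    and G :: "'r set"
    and Y_GFM :: "complex \<Rightarrow> complex^2^2"
    and \<omega>\<^sub>0 B_eq :: real
  assumes "ac_network w G"
    and "inverters_coupled w G"
    and "grounded_laplacian w G B"
    and "sym_pos_def B"
    and "\<omega>\<^sub>0 > 0"
    and "B_eq > 0"
  shows "invertible (block22 (B_mod B B_eq)) \<and>
    (\<forall>s. s\<^sup>2 / of_real \<omega>\<^sub>0 + of_real \<omega>\<^sub>0 \<noteq> 0 \<and> Y_GFM s = B_eq *\<^sub>R F_net \<omega>\<^sub>0 s \<longrightarrow>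
       invertible (gfm_side_admittance B (F_net \<omega>\<^sub>0 s) (Y_GFM s)) \<and>
       sub1_admittance B (F_net \<omega>\<^sub>0 s) (Y_GFM s) =
         cmat (schur_complement (B_mod B B_eq)) \<otimes>\<^sub>K F_net \<omega>\<^sub>0 s) \<and>
    smallest_eigenvalue (schur_complement (B_mod B B_eq)) > smallest_eigenvalue B"
proof (intro conjI allI impI; (elim conjE)?)
  show inv: "invertible (block22 (B_mod B B_eq))"
    using assms by (intro sym_pos_def_imp_invertible_block22 sym_pos_def_B_mod)
  fix s assume s: "s\<^sup>2 / of_real \<omega>\<^sub>0 + of_real \<omega>\<^sub>0 \<noteq> 0" and Y: "Y_GFM s = B_eq *\<^sub>R F_net \<omega>\<^sub>0 s"
  have F: "invertible (F_net \<omega>\<^sub>0 s)"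
    using s \<open>\<omega>\<^sub>0 > 0\<close> by (simp add: invertible_det_nz det_F_net)
  show "invertible (gfm_side_admittance B (F_net \<omega>\<^sub>0 s) (Y_GFM s))"
    and "sub1_admittance B (F_net \<omega>\<^sub>0 s) (Y_GFM s) =
      cmat (schur_complement (B_mod B B_eq)) \<otimes>\<^sub>K F_net \<omega>\<^sub>0 s"
    unfolding Y by (fact sub1_admittance_eq_kronecker[OF inv F])+
next
  show "smallest_eigenvalue (schur_complement (B_mod B B_eq)) > smallest_eigenvalue B"
    using assms by (intro smallest_eigenvalue_schur_complement_gt)
qed

end
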